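(* Let $G=G^*\cup tK_1$, where $t\ge 2$ and $G^*$ is a graph with at least two edges. Then $\mathrm{st}(n,G)=\mathrm{ex}(n,G^* )$ for all $n\ge |G|$.
   Context: Graphs are finite and simple; $|G|$ is the number of vertices of $G$; $\cup$ denotes vertex-disjoint union and $tK_1$ consists of $t$ isolated vertices. $\mathrm{ex}(n,G)$ is the maximum number of edges of a graph on $n$ vertices containing no (not necessarily induced) copy of $G$. For a non-complete graph $G$ on $k$ vertices and $n\ge k$, $\mathrm{st}(n,G)$ is the largest $m$ for which there is a graph $H$ with $n$ vertices and $m$ edges such that no subgraph $F\subseteq H$ on exactly $k$ vertices contains $G$ as a proper subgraph. *)

theory Defs
  imports Main
begin

record 'a graph =
  verts :: "'a set"
  edges :: "'a set set"

definition simple_graph :: "'a graph \<Rightarrow> bool" where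
  "simple_graph G \<longleftrightarrow> finite (verts G) \<and> edges G \<subseteq> {e. e \<subseteq> verts G \<and> card e = 2}"

definition subgraph :: "'a graph \<Rightarrow> 'a graph \<Rightarrow> bool" where
  "subgraph F H \<longleftrightarrow>
     simple_graph F \<and> simple_graph H \<and> verts F \<subseteq> verts H \<and> edges F \<subseteq> edges H"

definition isomorphic :: "'a graph \<Rightarrow> 'b graph \<Rightarrow> bool" where
  "isomorphic G H \<longleftrightarrow>
     (\<exists>f. bij_betw f (verts G) (verts H) \<and> edges H = (\<lambda>e. f ` e) ` edges G)"

definition contains_copy :: "'b graph \<Rightarrow> 'a graph \<Rightarrow> bool" where
  "contains_copy H G \<longleftrightarrow> (\<exists>G'. subgraph G' H \<and> isomorphic G G')"

definition contains_proper_copy :: "'b graph \<Rightarrow> 'a graph \<Rightarrow> bool" where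
  "contains_proper_copy F G \<longleftrightarrow> (\<exists>G'. subgraph G' F \<and> G' \<noteq> F \<and> isomorphic G G')"

definition disjoint_union :: "'a graph \<Rightarrow> 'b graph \<Rightarrow> ('a + 'b) graph" where
  "disjoint_union G H =
     \<lparr>verts = verts G <+> verts H,
      edges = (\<lambda>e. Inl ` e) ` edges G \<union> (\<lambda>e. Inr ` e) ` edges H\<rparr>"

definition isolated_vertices :: "nat \<Rightarrow> nat graph" where
  "isolated_vertices t = \<lparr>verts = {..<t}, edges = {}\<rparr>"

text \<open>
  In the next two definitions the host graph \<open>H\<close> has natural numbers as vertices; every
  finite graph is isomorphic to one of this form. Both sets are finite, since a graph on \<open>n\<close>
  vertices has at most \<open>n choose 2\<close> edges. The set in \<open>ex_number\<close> is nonempty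
  whenever \<open>G\<close> has an edge, and the set in \<open>st_number\<close> is nonempty for every \<open>G\<close>, because the
  edgeless graph on \<open>n\<close> vertices qualifies. \<open>Max {}\<close> is unspecified.
  The notion \<open>st_number n G\<close> is meant for non-complete \<open>G\<close> and \<open>n \<ge> card (verts G)\<close>.
\<close>

definition ex_number :: "nat \<Rightarrow> 'a graph \<Rightarrow> nat" where
  "ex_number n G =
     Max {m. \<exists>H :: nat graph. simple_graph H \<and> card (verts H) = n \<and> card (edges H) = m \<and>
                \<not> contains_copy H G}"

definition st_number :: "nat \<Rightarrow> 'a graph \<Rightarrow> nat" where
  "st_number n G =
     Max {m. \<exists>H :: nat graph. simple_graph H \<and> card (verts H) = n \<and> card (edges H) = m \<and>
                \<not> (\<exists>F. subgraph F H \<and> card (verts F) = card (verts G) \<and>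
                       contains_proper_copy F G)}"

end

theory Submission imports Defs begin

text \<open>
  Write \<open>G\<close> for \<open>Gstar\<close> together with \<open>t\<close> isolated vertices. A host graph \<open>H\<close> is admissible
  for \<open>st_number n G\<close> iff every copy of \<open>G\<close> in \<open>H\<close> is induced. The numbers of edges of
  admissible graphs on \<open>n\<close> vertices are exactly those of graphs on \<open>n\<close> vertices without a copy
  of \<open>Gstar\<close>, so that the two maxima are taken over the same set. One inclusion holds because
  a graph without a copy of \<open>Gstar\<close> has no copy of \<open>G\<close> either and is therefore admissible.

  For the other inclusion, let \<open>H\<close> be admissible with \<open>n\<close> vertices and suppose that it contains a copy \<open>G'\<close> of
  \<open>Gstar\<close>. Since \<open>t \<ge> 2\<close> and \<open>n \<ge> card (verts G)\<close>, the end points of any given edge of \<open>H\<close> that lie outside \<open>G'\<close> can be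
  included among the \<open>t\<close> vertices which complete \<open>G'\<close> to a copy of \<open>G\<close>. That copy is induced,
  so the edge belongs to \<open>G'\<close>: the graph \<open>H\<close> has no edges besides those of \<open>G'\<close>
  (\<open>edges_eq_copy_edges\<close>). It remains to find a graph on the same vertices with
  equally many edges and no copy of \<open>Gstar\<close>. Such a copy would use all the edges, so it suffices
  that the edges of the new graph cover a different number of vertices. Moving a single edge
  achieves this (\<open>same_size_different_cover\<close>): if two edges meet, one of them is moved to two
  uncovered vertices, and if the edges form a matching, one of them is moved so as to meet
  another one.
\<close>

lemma isomorphic_card_edges:
  assumes "simple_graph G" "isomorphic G G'"
  shows "card (edges G') = card (edges G)"
    and "card (\<Union> (edges G')) = card (\<Union> (edges G))"
proof -
  obtain f where f: "bij_betw f (verts G) (verts G')" and e: "edges G' = (\<lambda>e. f ` e) ` edges G"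
    using assms(2) unfolding isomorphic_def by blast
  have inj: "inj_on f (verts G)" using f by (rule bij_betw_imp_inj_on)
  have sub: "edges G \<subseteq> Pow (verts G)" using assms(1) unfolding simple_graph_def by auto
  have "inj_on (\<lambda>e. f ` e) (edges G)"
    using inj_on_image_Pow[OF inj] sub by (rule inj_on_subset)
  then show "card (edges G') = card (edges G)" unfolding e by (rule card_image)
  have "\<Union> (edges G') = f ` \<Union> (edges G)" unfolding e by auto
  moreover have "inj_on f (\<Union> (edges G))" using inj by (rule inj_on_subset) (use sub in auto)
  ultimately show "card (\<Union> (edges G')) = card (\<Union> (edges G))" by (simp add: card_image)
qed

lemma card_verts_add_isolated:
  assumes "simple_graph G"
  shows "card (verts (disjoint_union G (isolated_vertices t))) = card (verts G) + t"
  using assms by (simp add: disjoint_union_def isolated_vertices_def simple_graph_def card_Plus)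

lemma isomorphic_add_isolated:
  assumes "isomorphic G G'" "finite W" "card W = t" "W \<inter> verts G' = {}"
  shows "isomorphic (disjoint_union G (isolated_vertices t))
    \<lparr>verts = verts G' \<union> W, edges = edges G'\<rparr>"
proof -
  obtain f where f: "bij_betw f (verts G) (verts G')" and e: "edges G' = (\<lambda>e. f ` e) ` edges G"
    using assms(1) unfolding isomorphic_def by blast
  obtain g where g: "bij_betw g {..<t} W"
    using ex_bij_betw_nat_finite[OF assms(2)] assms(3) by (auto simp: atLeast0LessThan)
  have ne: "f a \<noteq> g b" if "a \<in> verts G" "b < t" for a b
    using bij_betwE[OF f] bij_betwE[OF g] assms(4) that by fastforce
  have "bij_betw (case_sum f g) (verts G <+> {..<t}) (verts G' \<union> W)"
    unfolding bij_betw_def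
  proof
    show "inj_on (case_sum f g) (verts G <+> {..<t})"
    proof (rule inj_onI)
      fix x y assume "x \<in> verts G <+> {..<t}" "y \<in> verts G <+> {..<t}"
        "case_sum f g x = case_sum f g y"
      then show "x = y"
        using inj_onD[OF bij_betw_imp_inj_on[OF f]] inj_onD[OF bij_betw_imp_inj_on[OF g]] ne
        by (cases x; cases y) (auto dest: sym)
    qed
    show "case_sum f g ` (verts G <+> {..<t}) = verts G' \<union> W"
      using f g by (simp add: Plus_def image_Un image_image bij_betw_def)
  qed
  then show ?thesis
    unfolding isomorphic_def disjoint_union_def isolated_vertices_def
    by (intro exI[of _ "case_sum f g"]) (simp add: e image_image)
qed

lemma contains_copy_of_add_isolated:
  assumes "contains_copy H (disjoint_union G (isolated_vertices t))" "simple_graph G"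
  shows "contains_copy H G"
proof -
  obtain G' f where G': "subgraph G' H"
    and f: "bij_betw f (verts G <+> {..<t}) (verts G')"
    and e: "edges G' = (\<lambda>e. f ` e) ` (\<lambda>e. Inl ` e) ` edges G"
    using assms(1)
    unfolding contains_copy_def isomorphic_def disjoint_union_def isolated_vertices_def
    by auto
  define h where "h = f \<circ> Inl"
  define K where "K = \<lparr>verts = h ` verts G, edges = edges G'\<rparr>"
  have e': "edges G' = (\<lambda>e. h ` e) ` edges G" unfolding e h_def by (simp add: image_image image_comp)
  have "inj_on f (verts G <+> {..<t})" using f by (rule bij_betw_imp_inj_on)
  then have "inj_on h (verts G)" unfolding h_def by (auto simp: inj_on_def)
  then have iso: "isomorphic G K"
    unfolding isomorphic_def K_def by (auto simp: bij_betw_def e')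
  have "h ` verts G \<subseteq> verts G'" using f unfolding h_def by (auto simp: bij_betw_def)
  moreover have "\<forall>e\<in>edges G'. e \<subseteq> h ` verts G"
    using assms(2) unfolding e' simple_graph_def by auto
  moreover have "finite (h ` verts G)" using assms(2) unfolding simple_graph_def by simp
  ultimately have "subgraph K H"
    using G' unfolding subgraph_def simple_graph_def K_def by auto
  then show ?thesis using iso unfolding contains_copy_def by blast
qed

text \<open>
  If every copy of \<open>G\<close> plus \<open>t \<ge> 2\<close> isolated vertices in \<open>H\<close> is induced, and \<open>H\<close> has enough
  vertices for such a copy, then a copy of \<open>G\<close> already contains all edges of \<open>H\<close>.
\<close>

lemma edges_eq_copy_edges:
  assumes G: "simple_graph G" and t: "t \<ge> 2" and n: "card (verts G) + t \<le> card (verts H)"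
    and sub: "subgraph G' H" and iso: "isomorphic G G'"
    and H: "\<And>F. subgraph F H \<Longrightarrow> card (verts F) = card (verts G) + t \<Longrightarrow>
              \<not> contains_proper_copy F (disjoint_union G (isolated_vertices t))"
  shows "edges H = edges G'"
proof (rule ccontr)
  assume "edges H \<noteq> edges G'"
  then obtain e where e: "e \<in> edges H" "e \<notin> edges G'" using sub unfolding subgraph_def by blast
  have finH: "finite (verts H)" and simp': "simple_graph G'" and simpH: "simple_graph H"
    and vsub: "verts G' \<subseteq> verts H" and esub: "edges G' \<subseteq> edges H"
    using sub unfolding subgraph_def simple_graph_def by auto
  have finG': "finite (verts G')" using vsub finH finite_subset by blast
  have card': "card (verts G') = card (verts G)"
    using iso unfolding isomorphic_def by (auto dest: bij_betw_same_card)
  have ev: "e \<subseteq> verts H" "card e = 2" using simpH e(1) unfolding simple_graph_def by auto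
  have fine: "finite e" using ev(1) finH finite_subset by blast
  have "card (e - verts G') \<le> t"
    using card_mono[OF fine, of "e - verts G'"] ev(2) t by auto
  moreover have "t \<le> card (verts H - verts G')"
    using card_Diff_subset[OF finG' vsub] card' n by simp
  \<comment> \<open>the \<open>t\<close> additional vertices include the end points of \<open>e\<close> outside \<open>G'\<close>\<close>
  ultimately obtain W where W: "e - verts G' \<subseteq> W" "W \<subseteq> verts H - verts G'" "card W = t"
    using exists_subset_between[of "e - verts G'" t "verts H - verts G'"] ev(1) finH by auto
  have finW: "finite W" using W(2) finH finite_subset by blast
  define K where "K = \<lparr>verts = verts G' \<union> W, edges = edges G'\<rparr>"
  define F where "F = \<lparr>verts = verts G' \<union> W, edges = insert e (edges G')\<rparr>"
  have disj: "W \<inter> verts G' = {}" using W(2) by blast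
  have isoK: "isomorphic (disjoint_union G (isolated_vertices t)) K"
    unfolding K_def by (rule isomorphic_add_isolated[OF iso finW W(3) disj])
  have simpF: "simple_graph F"
    using simp' finW W(1) ev unfolding simple_graph_def F_def by auto
  have FH: "subgraph F H"
    using simpF simpH vsub esub W(2) e(1) unfolding subgraph_def F_def by auto
  have "simple_graph K" using simp' finW unfolding simple_graph_def K_def by auto
  then have KF: "subgraph K F" using simpF unfolding subgraph_def K_def F_def by auto
  have ne: "K \<noteq> F" using e(2) unfolding K_def F_def by auto
  have "card (verts F) = card (verts G) + t"
    using card_Un_disjoint[of "verts G'" W] finG' finW disj W(3) card'
    unfolding F_def by (simp add: Int_commute)
  then have "\<not> contains_proper_copy F (disjoint_union G (isolated_vertices t))"
    using H FH by blast
  then show False using KF ne isoK unfolding contains_proper_copy_def by blast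
qed

lemma same_size_different_cover:
  assumes E: "E \<subseteq> {e. e \<subseteq> V \<and> card e = 2}" and fin: "finite V"
    and two: "card E \<ge> 2" and free: "card (V - \<Union>E) \<ge> 2"
  shows "\<exists>E'. E' \<subseteq> {e. e \<subseteq> V \<and> card e = 2} \<and> card E' = card E \<and> card (\<Union>E') \<noteq> card (\<Union>E)"
proof -
  have finE: "finite E" using two by (metis card.infinite not_numeral_le_zero)
  have UV: "\<Union>E \<subseteq> V" using E by auto
  have finU: "finite (\<Union>E)" using UV fin finite_subset by blast
  show ?thesis
  proof (cases "\<exists>e1\<in>E. \<exists>e2\<in>E. e1 \<noteq> e2 \<and> e1 \<inter> e2 \<noteq> {}")
    case True
    then obtain e1 e2 v where e: "e1 \<in> E" "e2 \<in> E" "e1 \<noteq> e2" "v \<in> e1" "v \<in> e2" by blast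
    obtain a where a: "e1 = {v, a}" "a \<noteq> v"
      using E e(1,4) by (auto simp: card_2_iff)
    obtain P where P: "P \<subseteq> V - \<Union>E" "card P = 2"
      using obtain_subset_with_card_n[OF free] by metis
    have finP: "finite P" "P \<noteq> {}" using P(2) card.infinite by fastforce+
    have PE: "P \<notin> E" using P finP by auto
    define E' where "E' = insert P (E - {e1})"
    have "card E' = card E"
      unfolding E'_def using e(1) finE PE by (simp add: card.insert_remove card_Suc_Diff1 del: card_Diff_insert)
    moreover have "E' \<subseteq> {e. e \<subseteq> V \<and> card e = 2}" unfolding E'_def using E P by auto
    moreover have "card (\<Union>E') > card (\<Union>E)"
    proof -
      \<comment> \<open>only \<open>a\<close> can become uncovered, since \<open>v\<close> remains covered by \<open>e2\<close>\<close>
      have "(\<Union>E - {a}) \<union> P \<subseteq> \<Union>E'" unfolding E'_def using e a(1) by auto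
      moreover have "\<Union>E' \<subseteq> V" unfolding E'_def using UV P by auto
      ultimately have "card ((\<Union>E - {a}) \<union> P) \<le> card (\<Union>E')"
        using fin finite_subset card_mono by meson
      moreover have "card ((\<Union>E - {a}) \<union> P) = card (\<Union>E - {a}) + card P"
        using finU finP P(1) by (intro card_Un_disjoint) auto
      moreover have "card (\<Union>E - {a}) \<ge> card (\<Union>E) - 1"
        using diff_card_le_card_Diff[of "{a}" "\<Union>E"] by simp
      ultimately show ?thesis using P(2) by linarith
    qed
    ultimately show ?thesis by (intro exI[of _ E']) auto
  next
    case False
    then have disj: "\<And>e e'. e \<in> E \<Longrightarrow> e' \<in> E \<Longrightarrow> e \<noteq> e' \<Longrightarrow> e \<inter> e' = {}" by blast
    obtain e1 e2 where e: "e1 \<in> E" "e2 \<in> E" "e1 \<noteq> e2"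
      using two card_le_Suc0_iff_eq[OF finE] by fastforce
    obtain b b' where b: "e1 = {b', b}" using E e(1) by (auto simp: card_2_iff)
    obtain c d where cd: "e2 = {c, d}" "c \<noteq> d" using E e(2) by (auto simp: card_2_iff)
    have bc: "b \<noteq> c" "b \<noteq> d" "b' \<noteq> c" "b' \<noteq> d" using disj[OF e] b cd by auto
    have only: "\<And>e'. e' \<in> E \<Longrightarrow> e' \<noteq> e2 \<Longrightarrow> c \<notin> e' \<and> d \<notin> e'"
      using disj[OF _ e(2)] cd by blast
    define E' where "E' = insert {b, c} (E - {e2})"
    have "{b, c} \<notin> E - {e2}" using only by blast
    then have "card E' = card E"
      unfolding E'_def using card_Suc_Diff1[OF finE e(2)] finE by (simp del: card_Diff_insert)
    moreover have "E' \<subseteq> {e. e \<subseteq> V \<and> card e = 2}"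
      unfolding E'_def using E e b cd bc(1) by auto
    moreover have "card (\<Union>E') < card (\<Union>E)"
    proof (rule psubset_card_mono[OF finU])
      have "\<Union>E' \<subseteq> \<Union>E" unfolding E'_def using e b cd by auto
      \<comment> \<open>\<open>e2\<close> was the only edge at \<open>d\<close>\<close>
      moreover have "d \<notin> \<Union>E'" unfolding E'_def using only bc cd by auto
      moreover have "d \<in> \<Union>E" using e cd by auto
      ultimately show "\<Union>E' \<subset> \<Union>E" by blast
    qed
    ultimately show ?thesis by (intro exI[of _ E']) auto
  qed
qed

theorem theorem7:
  fixes Gstar :: "'a graph" and G :: "('a + nat) graph" and t n :: nat
  assumes "simple_graph Gstar"
    and "card (edges Gstar) \<ge> 2"
    and "t \<ge> 2"
    and "G = disjoint_union Gstar (isolated_vertices t)"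
    and "n \<ge> card (verts G)"
  shows "st_number n G = ex_number n Gstar"
proof -
  let ?adm = "\<lambda>H :: nat graph. \<not> (\<exists>F. subgraph F H \<and> card (verts F) = card (verts G) \<and>
                       contains_proper_copy F G)"
  define A where "A = {m. \<exists>H :: nat graph. simple_graph H \<and> card (verts H) = n \<and>
                          card (edges H) = m \<and> ?adm H}"
  define B where "B = {m. \<exists>H :: nat graph. simple_graph H \<and> card (verts H) = n \<and>
                          card (edges H) = m \<and> \<not> contains_copy H Gstar}"
  have cG: "card (verts G) = card (verts Gstar) + t"
    using card_verts_add_isolated[OF assms(1)] assms(4) by simp
  have BA: "B \<subseteq> A"
  proof -
    have "?adm H" if H: "\<not> contains_copy H Gstar" for H
    proof
      assume "\<exists>F. subgraph F H \<and> card (verts F) = card (verts G) \<and> contains_proper_copy F G"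
      then obtain F K where "subgraph F H" "subgraph K F" "isomorphic G K"
        unfolding contains_proper_copy_def by blast
      moreover from this have "subgraph K H" unfolding subgraph_def by blast
      ultimately have "contains_copy H G" unfolding contains_copy_def by blast
      then show False using contains_copy_of_add_isolated assms(1,4) H by blast
    qed
    then show ?thesis unfolding A_def B_def by blast
  qed
  have dom: "m \<in> B" if "m \<in> A" for m
  proof -
    obtain H where H: "simple_graph H" "card (verts H) = n" "card (edges H) = m" "?adm H"
      using \<open>m \<in> A\<close> unfolding A_def by (elim CollectE exE conjE) (rule that)
    show ?thesis
    proof (cases "contains_copy H Gstar")
      case False
      then show ?thesis using H unfolding B_def by blast
    next
      case True
      then obtain G' where G': "subgraph G' H" "isomorphic Gstar G'"
        unfolding contains_copy_def by blast
      have eq: "edges H = edges G'"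
        by (rule edges_eq_copy_edges[OF assms(1,3) _ G']) (use H(2,4) assms(4,5) cG in auto)
      note iso = isomorphic_card_edges[OF assms(1) G'(2)]
      have finH: "finite (verts H)" and EH: "edges H \<subseteq> {e. e \<subseteq> verts H \<and> card e = 2}"
        using H(1) unfolding simple_graph_def by auto
      have "\<Union> (edges H) \<subseteq> verts G'" using G'(1) eq unfolding subgraph_def simple_graph_def by auto
      moreover have fin': "finite (verts G')" and sub': "verts G' \<subseteq> verts H"
        using G'(1) unfolding subgraph_def simple_graph_def by auto
      ultimately have "card (verts H - verts G') \<le> card (verts H - \<Union> (edges H))"
        using finH by (intro card_mono) auto
      moreover have "card (verts G') = card (verts Gstar)"
        using G'(2) unfolding isomorphic_def by (auto dest: bij_betw_same_card)
      then have "card (verts H - verts G') \<ge> 2"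
        using card_Diff_subset[OF fin' sub'] H(2) assms(3,5) cG by simp
      ultimately have "card (verts H - \<Union> (edges H)) \<ge> 2" by linarith
      moreover have "card (edges H) \<ge> 2" using iso(1) eq assms(2) by simp
      ultimately obtain E' where E': "E' \<subseteq> {e. e \<subseteq> verts H \<and> card e = 2}"
        "card E' = card (edges H)" "card (\<Union>E') \<noteq> card (\<Union> (edges H))"
        using same_size_different_cover[OF EH finH] by blast
      define H' where "H' = \<lparr>verts = verts H, edges = E'\<rparr>"
      have simp': "simple_graph H'" using finH E'(1) unfolding simple_graph_def H'_def by auto
      have "\<not> contains_copy H' Gstar"
      proof
        assume "contains_copy H' Gstar"
        then obtain K where K: "subgraph K H'" "isomorphic Gstar K"
          unfolding contains_copy_def by blast
        note isoK = isomorphic_card_edges[OF assms(1) K(2)]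
        have "edges K \<subseteq> E'" using K(1) unfolding subgraph_def H'_def by simp
        moreover have "finite E'" using E'(2) assms(2) iso(1) eq by (intro card_ge_0_finite) simp
        ultimately have "edges K = E'"
          using card_subset_eq isoK(1) iso(1) E'(2) eq by metis
        then show False using isoK(2) iso(2) E'(3) eq by simp
      qed
      then show ?thesis using simp' H(2,3) E'(2) unfolding B_def
        by (intro CollectI exI[of _ H']) (simp add: H'_def)
    qed
  qed
  have "A = B" using BA dom by blast
  then show ?thesis unfolding st_number_def ex_number_def A_def B_def by simp
qed

end
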